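(* Let $K:S^1\to\mathbb R^2$, $\varphi\mapsto Y(\varphi)$, be a positively oriented regular $C^2$ curve with non-vanishing curvature. Let $n\ge3$ and let $f_i:S^1\to S^1$, $1\le i\le n$, be orientation preserving $C^2$ diffeomorphisms with $f_n=(f_{n-1}\circ\cdots\circ f_1)^{-1}$. Put $g_0=\mathrm{id}_{S^1}$ and $g_i=f_i\circ f_{i-1}\circ\cdots\circ f_1$ for $1\le i\le n$. Assume that $g_j\circ g_i^{-1}$ has no fixed points for all $1\le i<j\le n$, that the points $Y(g_i(\varphi))$, $i\in\{0,\ldots,n-1\}$, are pairwise different for every $\varphi\in S^1$, and that for every $i\in\{1,\ldots,n\}$ $$\langle(Y\circ g_i-Y\circ g_{i-1})',J(Y\circ g_i-Y\circ g_{i-1})\rangle\neq0\quad\text{everywhere on }S^1.$$ For $1\le i\le n$ let $C_i$ be the curve parametrized by $$X_i=Y\circ g_{i-1}-\frac{\langle(Y\circ g_{i-1})',J(Y\circ g_i-Y\circ g_{i-1})\rangle}{\langle(Y\circ g_i-Y\circ g_{i-1})',J(Y\circ g_i-Y\circ g_{i-1})\rangle}\,(Y\circ g_i-Y\circ g_{i-1}).$$ Then $C_i$ is the envelope of the lines through $Y(g_{i-1}(\varphi))$ and $Y(g_i(\varphi))$, $\varphi\in S^1$, and $(K,C_1,\ldots,C_n)$ is a Poncelet clan, with Poncelet polygons having the vertices $Y(g_0(\varphi)),\ldots,Y(g_{n-1}(\varphi))$.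
   Context: Here $S^1=\mathbb R/2\pi\mathbb Z$, $\langle\cdot,\cdot\rangle$ is the Euclidean inner product and $J=\begin{pmatrix}0&-1\\1&0\end{pmatrix}$. Envelope: $X_i(\varphi)$ lies on the line through $Y(g_{i-1}(\varphi))$ and $Y(g_i(\varphi))$, and $X_i'(\varphi)$ is parallel to that line (with $X_i'(\varphi)=0$ allowed); the line is then said to be tangent to $C_i$ at $X_i(\varphi)$. Poncelet clan: closed curves $(K,C_1,\ldots,C_n)$ form a Poncelet clan if they have the following closing property: if a polygon inscribed in $K$ exists such that each of its sides is tangent to one of the curves $C_1,\ldots,C_n$, then infinitely many such polygons (Poncelet polygons) exist which touch $C_1,\ldots,C_n$ in the same order. Tangency of the prolongation of a side is allowed. Here this means that for each $\varphi$ the closed polygon with vertices $Y(g_0(\varphi)),\ldots,Y(g_{n-1}(\varphi))$ has its $i$-th side line, through $Y(g_{i-1}(\varphi))$ and $Y(g_i(\varphi))$, tangent to $C_i$. *)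

theory Defs
  imports "HOL-Analysis.Analysis"
begin

section \<open>The circle and its differentiable structure\<close>

quotient_type circle = real / "\<lambda>x y :: real. \<exists>k::int. y - x = 2 * pi * of_int k"
  morphisms rep_circle proj
proof (rule equivpI)
  show "reflp (\<lambda>x y :: real. \<exists>k::int. y - x = 2 * pi * of_int k)"
    by (auto intro!: reflpI exI[of _ 0])
  show "symp (\<lambda>x y :: real. \<exists>k::int. y - x = 2 * pi * of_int k)"
  proof (rule sympI)
    fix x y :: real
    assume "\<exists>k::int. y - x = 2 * pi * of_int k"
    then obtain k :: int where "y - x = 2 * pi * of_int k" ..
    then have "x - y = 2 * pi * of_int (- k)" by simp
    then show "\<exists>k::int. x - y = 2 * pi * of_int k" ..
  qed
  show "transp (\<lambda>x y :: real. \<exists>k::int. y - x = 2 * pi * of_int k)"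
  proof (rule transpI)
    fix x y z :: real
    assume "\<exists>k::int. y - x = 2 * pi * of_int k" "\<exists>k::int. z - y = 2 * pi * of_int k"
    then obtain k l :: int where "y - x = 2 * pi * of_int k" "z - y = 2 * pi * of_int l" by blast
    then have "z - x = 2 * pi * of_int (k + l)" by (simp add: algebra_simps)
    then show "\<exists>k::int. z - x = 2 * pi * of_int k" ..
  qed
qed

lemma proj_eq_iff: "proj x = proj y \<longleftrightarrow> (\<exists>k::int. y - x = 2 * pi * of_int k)"
  by (rule circle.abs_eq_iff)

lemma proj_rep_circle [simp]: "proj (rep_circle \<phi>) = \<phi>"
  by (rule Quotient3_abs_rep[OF Quotient3_circle])

text \<open>Differentiation of maps on the circle is differentiation of their pull-backs to the real
  line; by periodicity the choice of representative is irrelevant (see \<open>circle_deriv_proj\<close>).\<close>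

definition circle_differentiable :: "(circle \<Rightarrow> 'a::real_normed_vector) \<Rightarrow> circle \<Rightarrow> bool" where
  "circle_differentiable h \<phi> \<longleftrightarrow> (\<lambda>t. h (proj t)) differentiable (at (rep_circle \<phi>))"

definition circle_deriv :: "(circle \<Rightarrow> 'a::real_normed_vector) \<Rightarrow> circle \<Rightarrow> 'a" where
  "circle_deriv h \<phi> = vector_derivative (\<lambda>t. h (proj t)) (at (rep_circle \<phi>))"

lemma has_vector_derivative_proj_cong:
  assumes "proj s = proj t"
  shows "((\<lambda>u. h (proj u)) has_vector_derivative D) (at s) \<longleftrightarrow>
         ((\<lambda>u. h (proj u)) has_vector_derivative D) (at t)"
proof -
  have imp: "((\<lambda>u. h (proj u)) has_vector_derivative D) (at b)"
    if ab: "proj a = proj b" and D: "((\<lambda>u. h (proj u)) has_vector_derivative D) (at a)" for a b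
  proof -
    obtain k :: int where k: "b - a = 2 * pi * of_int k"
      using ab[unfolded proj_eq_iff] ..
    have shift: "proj (u + (a - b)) = proj u" for u
      unfolding proj_eq_iff by (rule exI[of _ k]) (use k in linarith)
    have "((\<lambda>u. u + (a - b)) has_vector_derivative 1) (at b)"
      unfolding has_real_derivative_iff_has_vector_derivative[symmetric]
      by (rule derivative_eq_intros refl | simp)+
    moreover have "((\<lambda>u. h (proj u)) has_vector_derivative D) (at (b + (a - b)))"
      using D by simp
    ultimately have "((\<lambda>u. h (proj u)) \<circ> (\<lambda>u. u + (a - b)) has_vector_derivative 1 *\<^sub>R D) (at b)"
      by (rule vector_diff_chain_at)
    then show ?thesis by (simp add: o_def shift)
  qed
  show ?thesis using imp[of s t] imp[of t s] assms by metis
qed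

lemma circle_deriv_proj:
  "circle_deriv h (proj t) = vector_derivative (\<lambda>s. h (proj s)) (at t)"
  unfolding circle_deriv_def vector_derivative_def
  using has_vector_derivative_proj_cong[of "rep_circle (proj t)" t h] by simp

lemma circle_differentiable_proj:
  fixes h :: "circle \<Rightarrow> 'a::real_normed_vector"
  shows "circle_differentiable h (proj t) \<longleftrightarrow> (\<lambda>s. h (proj s)) differentiable (at t)"
proof -
  have "(h' differentiable at u) \<longleftrightarrow> (\<exists>D. (h' has_vector_derivative D) (at u))"
    for h' :: "real \<Rightarrow> 'a" and u
    using vector_derivative_works differentiableI_vector by blast
  then show ?thesis
    unfolding circle_differentiable_def
    using has_vector_derivative_proj_cong[of "rep_circle (proj t)" t h] by simp
qed

definition C2 :: "(real \<Rightarrow> 'a::real_normed_vector) \<Rightarrow> bool" where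
  "C2 h \<longleftrightarrow> h C1_differentiable_on UNIV \<and>
            (\<lambda>t. vector_derivative h (at t)) C1_differentiable_on UNIV"

definition is_lift :: "(circle \<Rightarrow> circle) \<Rightarrow> (real \<Rightarrow> real) \<Rightarrow> bool" where
  "is_lift f F \<longleftrightarrow> (\<forall>t. f (proj t) = proj (F t))"

definition C2_circle_map :: "(circle \<Rightarrow> circle) \<Rightarrow> bool" where
  "C2_circle_map f \<longleftrightarrow> (\<exists>F. is_lift f F \<and> C2 F)"

definition orientation_preserving :: "(circle \<Rightarrow> circle) \<Rightarrow> bool" where
  "orientation_preserving f \<longleftrightarrow> (\<exists>F. is_lift f F \<and> continuous_on UNIV F \<and> strict_mono F)"

definition C2_circle_diffeo :: "(circle \<Rightarrow> circle) \<Rightarrow> bool" where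
  "C2_circle_diffeo f \<longleftrightarrow> bij f \<and> C2_circle_map f \<and> C2_circle_map (inv f)"

primrec iter_comp :: "(nat \<Rightarrow> circle \<Rightarrow> circle) \<Rightarrow> nat \<Rightarrow> circle \<Rightarrow> circle" where
  "iter_comp f 0 = id"
| "iter_comp f (Suc i) = f (Suc i) \<circ> iter_comp f i"

section \<open>Plane closed curves\<close>

definition J :: "real^2^2" where
  "J = vector [vector [0, -1], vector [1, 0]]"

definition closed_curve :: "(circle \<Rightarrow> real^2) \<Rightarrow> bool" where
  "closed_curve C \<longleftrightarrow> continuous_on UNIV (\<lambda>t. C (proj t))"

definition regular_C2_curve :: "(circle \<Rightarrow> real^2) \<Rightarrow> bool" where
  "regular_C2_curve Y \<longleftrightarrow> C2 (\<lambda>t. Y (proj t)) \<and> (\<forall>\<phi>. circle_deriv Y \<phi> \<noteq> 0)"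

definition curvature :: "(circle \<Rightarrow> real^2) \<Rightarrow> circle \<Rightarrow> real" where
  "curvature Y \<phi> =
     (J *v circle_deriv Y \<phi>) \<bullet> circle_deriv (circle_deriv Y) \<phi> / norm (circle_deriv Y \<phi>) ^ 3"

definition turning_number :: "(circle \<Rightarrow> real^2) \<Rightarrow> real" where
  "turning_number Y =
     integral {0..2*pi} (\<lambda>t. curvature Y (proj t) * norm (circle_deriv Y (proj t))) / (2 * pi)"

text \<open>The curve is not required to be simple, so orientation is read off from the turning number.
  For a simple closed curve the turning number is 1 or -1, and it is 1 exactly for the
  counterclockwise orientation.\<close>

definition positively_oriented :: "(circle \<Rightarrow> real^2) \<Rightarrow> bool" where
  "positively_oriented Y \<longleftrightarrow> turning_number Y > 0"

section \<open>Tangency, envelopes and Poncelet clans\<close>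

text \<open>The line through \<open>P\<close> and \<open>Q\<close> (not just the segment) is tangent to \<open>C\<close> at \<open>C \<psi>\<close>;
  the derivative of \<open>C\<close> may vanish there.\<close>

definition line_tangent_at :: "(circle \<Rightarrow> real^2) \<Rightarrow> circle \<Rightarrow> real^2 \<Rightarrow> real^2 \<Rightarrow> bool" where
  "line_tangent_at C \<psi> P Q \<longleftrightarrow>
     P \<noteq> Q \<and> C \<psi> \<in> affine hull {P, Q} \<and>
     circle_differentiable C \<psi> \<and> circle_deriv C \<psi> \<in> span {Q - P}"

definition is_envelope ::
  "(circle \<Rightarrow> real^2) \<Rightarrow> (circle \<Rightarrow> real^2) \<Rightarrow> (circle \<Rightarrow> real^2) \<Rightarrow> bool" where
  "is_envelope C P Q \<longleftrightarrow> (\<forall>\<phi>. line_tangent_at C \<phi> (P \<phi>) (Q \<phi>))"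

text \<open>The vertices are listed from index 0, the curves are \<open>C 1, \<dots>, C n\<close>; side \<open>i\<close> joins
  vertices \<open>i - 1\<close> and \<open>i\<close>, with vertex \<open>n\<close> being vertex \<open>0\<close>.\<close>

definition poncelet_polygon ::
  "nat \<Rightarrow> (circle \<Rightarrow> real^2) \<Rightarrow> (nat \<Rightarrow> circle \<Rightarrow> real^2) \<Rightarrow> (real^2) list \<Rightarrow> bool" where
  "poncelet_polygon n K C P \<longleftrightarrow>
     length P = n \<and> distinct P \<and> set P \<subseteq> range K \<and>
     (\<forall>i\<in>{1..n}. \<exists>\<psi>. line_tangent_at (C i) \<psi> (P ! (i - 1)) (P ! (i mod n)))"

definition poncelet_clan ::
  "nat \<Rightarrow> (circle \<Rightarrow> real^2) \<Rightarrow> (nat \<Rightarrow> circle \<Rightarrow> real^2) \<Rightarrow> bool" where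
  "poncelet_clan n K C \<longleftrightarrow>
     closed_curve K \<and> (\<forall>i\<in>{1..n}. closed_curve (C i)) \<and>
     ((\<exists>P. poncelet_polygon n K C P) \<longrightarrow> infinite {P. poncelet_polygon n K C P})"

end

theory Submission
  imports Defs
begin

text \<open>
  Write \<open>P\<close> and \<open>Q\<close> for two consecutive vertices as functions of the parameter and
  \<open>V = Q - P\<close>. A point \<open>P - q V\<close> of the moving line has velocity \<open>(P' - q V') - q' V\<close>, which is
  parallel to \<open>V\<close> exactly when \<open>P' - q V'\<close> is orthogonal to \<open>J V\<close>. This forces
  \<open>q = (P' \<bullet> J V) / (V' \<bullet> J V)\<close>, the coefficient in the definition of \<open>X i\<close>. As \<open>P\<close> and
  \<open>V\<close> are \<open>C\<^sup>2\<close>, \<open>q\<close> is differentiable and the argument applies (\<open>envelope_point_derivative\<close>).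

  The vertices are \<open>C\<^sup>2\<close> in the parameter because precomposing a \<open>C\<^sup>2\<close> curve with a
  \<open>C\<^sup>2\<close> map of the circle gives a \<open>C\<^sup>2\<close> curve (\<open>iter_comp_C2_curve\<close>). Since \<open>f n\<close> is
  inverse to \<open>g (n - 1)\<close>, the map \<open>g n\<close> is the identity, so the polygon with vertices
  \<open>Y (g i \<phi>)\<close> closes after \<open>n\<close> sides, for every \<open>\<phi>\<close>. There are infinitely many such polygons
  because the first vertex \<open>Y \<phi>\<close> runs through the image of a non-constant closed curve, which is
  connected and hence infinite (\<open>infinite_range_regular_curve\<close>).
\<close>

section \<open>Twice continuously differentiable functions\<close>

lemma derivative_imp_continuous_on:
  assumes "\<And>t. (k has_vector_derivative k' t) (at t)"
  shows "continuous_on UNIV k"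
  by (intro continuous_at_imp_continuous_on ballI has_vector_derivative_continuous[OF assms])

lemma C2I:
  assumes h: "\<And>t. (h has_vector_derivative h' t) (at t)"
    and h': "\<And>t. (h' has_vector_derivative h'' t) (at t)"
    and "continuous_on UNIV h''"
  shows "C2 h"
proof -
  have "(\<lambda>t. vector_derivative h (at t)) = h'"
    by (intro ext vector_derivative_at h)
  then show ?thesis
    unfolding C2_def C1_differentiable_on_eq
    using assms derivative_imp_continuous_on[OF h']
    by (auto intro: differentiableI_vector simp: vector_derivative_at[OF h'])
qed

lemma C2E:
  assumes "C2 h"
  obtains h' h'' where "\<And>t. (h has_vector_derivative h' t) (at t)"
    "\<And>t. (h' has_vector_derivative h'' t) (at t)" "continuous_on UNIV h''"
proof -
  obtain h' h'' where *: "\<And>t. (h has_vector_derivative h' t) (at t)"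
      "\<And>t. ((\<lambda>t. vector_derivative h (at t)) has_vector_derivative h'' t) (at t)"
      "continuous_on UNIV h''"
    using assms unfolding C2_def C1_differentiable_on_def by auto
  have "(\<lambda>t. vector_derivative h (at t)) = h'"
    by (intro ext vector_derivative_at *(1))
  with * show ?thesis by (intro that[of h' h'']) auto
qed

lemma C2_has_vector_derivative:
  assumes "C2 h"
  shows "(h has_vector_derivative vector_derivative h (at t)) (at t)"
proof -
  obtain h' where h': "\<And>t. (h has_vector_derivative h' t) (at t)"
    by (rule C2E[OF assms]) (rule that)
  show ?thesis using h'[of t] by (simp add: vector_derivative_at)
qed

lemma C2_derivative_differentiable:
  assumes "C2 h"
  shows "(\<lambda>t. vector_derivative h (at t)) differentiable (at t)"
  using assms unfolding C2_def C1_differentiable_on_def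
  by (auto intro: differentiableI_vector)

lemma C2_compose:
  fixes h :: "real \<Rightarrow> 'a::real_normed_vector" and F :: "real \<Rightarrow> real"
  assumes "C2 h" "C2 F"
  shows "C2 (\<lambda>t. h (F t))"
proof -
  obtain h' h'' where h: "\<And>t. (h has_vector_derivative h' t) (at t)"
      "\<And>t. (h' has_vector_derivative h'' t) (at t)" "continuous_on UNIV h''"
    by (rule C2E[OF assms(1)]) (rule that)
  obtain F' F'' where F: "\<And>t. (F has_vector_derivative F' t) (at t)"
      "\<And>t. (F' has_vector_derivative F'' t) (at t)" "continuous_on UNIV F''"
    by (rule C2E[OF assms(2)]) (rule that)
  have chain: "((\<lambda>t. k (F t)) has_vector_derivative F' t *\<^sub>R k' (F t)) (at t)"
    if "\<And>t. (k has_vector_derivative k' t) (at t)" for k k' :: "real \<Rightarrow> 'a" and t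
    using vector_diff_chain_at[OF F(1) that] by (simp add: o_def)
  have "((\<lambda>t. F' t *\<^sub>R h' (F t)) has_vector_derivative
      F' t *\<^sub>R (F' t *\<^sub>R h'' (F t)) + F'' t *\<^sub>R h' (F t)) (at t)" for t
    by (intro has_vector_derivative_scaleR chain[OF h(2)])
      (simp add: F(2) has_real_derivative_iff_has_vector_derivative)
  moreover have "continuous_on UNIV F" "continuous_on UNIV F'" "continuous_on UNIV h'"
    by (rule derivative_imp_continuous_on[OF F(1)] derivative_imp_continuous_on[OF F(2)]
        derivative_imp_continuous_on[OF h(2)])+
  then have "continuous_on UNIV (\<lambda>t. F' t *\<^sub>R (F' t *\<^sub>R h'' (F t)) + F'' t *\<^sub>R h' (F t))"
    using F(3) h(3)
    by (intro continuous_intros continuous_on_compose2[of UNIV h'' UNIV F]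
        continuous_on_compose2[of UNIV h' UNIV F]) auto
  ultimately show ?thesis
    by (intro C2I[OF chain[OF h(1)]])
qed

lemma C2_diff:
  assumes "C2 h" "C2 k"
  shows "C2 (\<lambda>t. h t - k t)"
proof -
  obtain h' h'' where h: "\<And>t. (h has_vector_derivative h' t) (at t)"
      "\<And>t. (h' has_vector_derivative h'' t) (at t)" "continuous_on UNIV h''"
    by (rule C2E[OF assms(1)]) (rule that)
  obtain k' k'' where k: "\<And>t. (k has_vector_derivative k' t) (at t)"
      "\<And>t. (k' has_vector_derivative k'' t) (at t)" "continuous_on UNIV k''"
    by (rule C2E[OF assms(2)]) (rule that)
  show ?thesis
    by (rule C2I[of _ "\<lambda>t. h' t - k' t" "\<lambda>t. h'' t - k'' t"])
      (use h k in \<open>auto intro: has_vector_derivative_diff continuous_on_diff\<close>)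
qed

section \<open>Iterated circle maps\<close>

lemma C2_circle_map_curve:
  assumes "C2_circle_map f" "C2 (\<lambda>t. Y (proj t))"
  shows "C2 (\<lambda>t. Y (f (proj t)))"
proof -
  obtain F where F: "\<And>t. f (proj t) = proj (F t)" "C2 F"
    using assms(1) unfolding C2_circle_map_def is_lift_def by blast
  show ?thesis
    using C2_compose[OF assms(2) F(2)] by (simp add: F(1))
qed

text \<open>The induction is on the number of maps, with the curve \<open>Y\<close> generalized: the outermost map is
  absorbed into the curve, so lifts of composites need not be tracked.\<close>

lemma iter_comp_C2_curve:
  assumes "\<And>i. i \<in> {1..m} \<Longrightarrow> C2_circle_map (f i)" "C2 (\<lambda>t. Y (proj t))"
  shows "C2 (\<lambda>t. Y (iter_comp f m (proj t)))"
  using assms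
proof (induction m arbitrary: Y)
  case 0
  then show ?case by simp
next
  case (Suc m)
  have "C2 (\<lambda>t. Y (f (Suc m) (proj t)))"
    using Suc.prems by (intro C2_circle_map_curve[of "f (Suc m)" Y]) auto
  then show ?case
    using Suc.IH[of "\<lambda>\<theta>. Y (f (Suc m) \<theta>)"] Suc.prems(1) by simp
qed

lemma bij_iter_comp:
  assumes "\<And>i. i \<in> {1..m} \<Longrightarrow> bij (f i)"
  shows "bij (iter_comp f m)"
  using assms by (induction m) (auto intro!: bij_comp)

section \<open>The envelope of a moving line\<close>

lemma J_mult: "(J *v v) $ 1 = - v $ 2" "(J *v v) $ 2 = v $ 1"
  by (simp_all add: J_def matrix_vector_mult_def sum_2)

lemma orthogonal_J_imp_span:
  fixes v w :: "real^2"
  assumes "v \<noteq> 0" "w \<bullet> (J *v v) = 0"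
  shows "w \<in> span {v}"
proof -
  have ortho: "w $ 2 * v $ 1 = w $ 1 * v $ 2"
    using assms(2) by (simp add: inner_vec_def sum_2 J_mult)
  have "(v \<bullet> v) *\<^sub>R w = (w \<bullet> v) *\<^sub>R v"
    using ortho by (simp add: vec_eq_iff forall_2 inner_vec_def sum_2) algebra
  then have "w = inverse (v \<bullet> v) *\<^sub>R (w \<bullet> v) *\<^sub>R v"
    using assms(1) by (simp add: eq_vector_fraction_iff flip: divide_inverse_commute)
  also have "\<dots> \<in> span {v}"
    by (intro span_mul span_base) simp
  finally show ?thesis .
qed

text \<open>Second derivatives enter only through the differentiability of the coefficient \<open>q\<close>; its
  derivative contributes a multiple of \<open>V\<close>, whatever its value.\<close>

lemma envelope_point_derivative:
  fixes P V :: "real \<Rightarrow> real^2"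
  defines "q \<equiv> \<lambda>s. (vector_derivative P (at s) \<bullet> (J *v V s)) /
                   (vector_derivative V (at s) \<bullet> (J *v V s))"
  assumes "C2 P" "C2 V" "V t \<noteq> 0" "vector_derivative V (at t) \<bullet> (J *v V t) \<noteq> 0"
  obtains d where "((\<lambda>s. P s - q s *\<^sub>R V s) has_vector_derivative d) (at t)" "d \<in> span {V t}"
proof -
  let ?P' = "\<lambda>s. vector_derivative P (at s)"
  let ?V' = "\<lambda>s. vector_derivative V (at s)"
  have V: "(V has_vector_derivative ?V' t) (at t)" and P: "(P has_vector_derivative ?P' t) (at t)"
    using assms by (auto intro: C2_has_vector_derivative)
  have "(\<lambda>s. J *v V s) differentiable (at t)"
    using V differentiableI_vector differentiable_compose[of "(*v) J" V t UNIV]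
      bounded_linear_imp_differentiable[OF matrix_vector_mul_bounded_linear]
    by blast
  then have "q differentiable (at t)"
    unfolding q_def using assms
    by (intro differentiable_divide differentiable_inner C2_derivative_differentiable) auto
  then obtain q' where "(q has_vector_derivative q') (at t)"
    using vector_derivative_works by blast
  then have "((\<lambda>s. P s - q s *\<^sub>R V s) has_vector_derivative
      ?P' t - (q t *\<^sub>R ?V' t + q' *\<^sub>R V t)) (at t)"
    using P V by (intro has_vector_derivative_diff has_vector_derivative_scaleR)
      (auto simp: has_real_derivative_iff_has_vector_derivative)
  moreover have "?P' t - (q t *\<^sub>R ?V' t + q' *\<^sub>R V t) \<in> span {V t}"
  proof -
    have "(?P' t - q t *\<^sub>R ?V' t) \<bullet> (J *v V t) = 0"
      unfolding q_def using assms(5) by (simp add: inner_diff_left)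
    then have "?P' t - q t *\<^sub>R ?V' t \<in> span {V t}"
      by (intro orthogonal_J_imp_span assms(4))
    then have "(?P' t - q t *\<^sub>R ?V' t) - q' *\<^sub>R V t \<in> span {V t}"
      by (rule span_diff) (simp add: span_base span_mul)
    then show ?thesis by (simp only: diff_diff_eq)
  qed
  ultimately show ?thesis by (rule that)
qed

lemma moving_line_envelope:
  fixes P Q C :: "circle \<Rightarrow> real^2"
  assumes P: "C2 (\<lambda>t. P (proj t))" and Q: "C2 (\<lambda>t. Q (proj t))"
    and ne: "\<And>\<phi>. P \<phi> \<noteq> Q \<phi>"
    and rot: "\<And>\<phi>. circle_deriv (\<lambda>\<theta>. Q \<theta> - P \<theta>) \<phi> \<bullet> (J *v (Q \<phi> - P \<phi>)) \<noteq> 0"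
    and C: "\<And>\<phi>. C \<phi> = P \<phi>
             - ((circle_deriv P \<phi> \<bullet> (J *v (Q \<phi> - P \<phi>)))
                / (circle_deriv (\<lambda>\<theta>. Q \<theta> - P \<theta>) \<phi> \<bullet> (J *v (Q \<phi> - P \<phi>))))
               *\<^sub>R (Q \<phi> - P \<phi>)"
  shows "is_envelope C P Q"
  unfolding is_envelope_def
proof
  fix \<phi>
  define t where "t = rep_circle \<phi>"
  have \<phi>: "\<phi> = proj t" by (simp add: t_def)
  obtain d where d: "((\<lambda>s. C (proj s)) has_vector_derivative d) (at t)"
      "d \<in> span {Q \<phi> - P \<phi>}"
    by (rule envelope_point_derivative[OF P C2_diff[OF Q P], of t])
      (use ne rot[of \<phi>] in \<open>auto simp: C \<phi> circle_deriv_proj\<close>)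
  have "circle_differentiable C \<phi>"
    using d(1) unfolding \<phi> circle_differentiable_proj by (rule differentiableI_vector)
  moreover have "circle_deriv C \<phi> = d"
    using d(1) unfolding \<phi> circle_deriv_proj by (rule vector_derivative_at)
  moreover have "P \<phi> - c *\<^sub>R (Q \<phi> - P \<phi>) \<in> affine hull {P \<phi>, Q \<phi>}" for c
    unfolding affine_hull_2 mem_Collect_eq
    by (rule exI[of _ "1 + c"], rule exI[of _ "- c"]) (simp add: algebra_simps)
  then have "C \<phi> \<in> affine hull {P \<phi>, Q \<phi>}"
    by (simp only: C)
  ultimately show "line_tangent_at C \<phi> (P \<phi>) (Q \<phi>)"
    unfolding line_tangent_at_def using ne d(2) by simp
qed

lemma is_envelope_closed_curve:
  assumes "is_envelope C P Q"
  shows "closed_curve C"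
  unfolding closed_curve_def
proof (intro continuous_at_imp_continuous_on ballI)
  fix t
  have "circle_differentiable C (proj t)"
    using assms unfolding is_envelope_def line_tangent_at_def by blast
  then show "isCont (\<lambda>t. C (proj t)) t"
    unfolding circle_differentiable_proj by (rule differentiable_imp_continuous_within)
qed

section \<open>Infinitely many polygons\<close>

lemma regular_C2_curve_continuous:
  assumes "regular_C2_curve Y"
  shows "continuous_on UNIV (\<lambda>t. Y (proj t))"
proof -
  have "C2 (\<lambda>t. Y (proj t))"
    using assms unfolding regular_C2_curve_def by blast
  then show ?thesis
    by (rule derivative_imp_continuous_on[OF C2_has_vector_derivative])
qed

lemma infinite_range_regular_curve:
  assumes "regular_C2_curve Y"
  shows "infinite (range Y)"
proof
  assume fin: "finite (range Y)"
  have "connected (range (\<lambda>t. Y (proj t)))"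
    by (intro connected_continuous_image regular_C2_curve_continuous assms connected_UNIV)
  moreover have "finite (range (\<lambda>t. Y (proj t)))"
    by (rule finite_subset[OF _ fin]) auto
  ultimately obtain c where "range (\<lambda>t. Y (proj t)) = {c}"
    using connected_finite_iff_sing by blast
  then have "Y (proj t) = c" for t by auto
  then have "circle_deriv Y (proj 0) = 0"
    by (simp add: circle_deriv_proj)
  then show False
    using assms unfolding regular_C2_curve_def by blast
qed

section \<open>The Poncelet clan\<close>

theorem mainTheorem11:
  fixes Y :: "circle \<Rightarrow> real^2" and n :: nat
    and f g :: "nat \<Rightarrow> circle \<Rightarrow> circle"
    and X :: "nat \<Rightarrow> circle \<Rightarrow> real^2"
  assumes "regular_C2_curve Y"
    and "positively_oriented Y"
    and "\<And>\<phi>. curvature Y \<phi> \<noteq> 0"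
    and "n \<ge> 3"
    and "\<And>i. i \<in> {1..n} \<Longrightarrow> C2_circle_diffeo (f i)"
    and "\<And>i. i \<in> {1..n} \<Longrightarrow> orientation_preserving (f i)"
    and "\<And>i. g i = iter_comp f i"
    and "f n = inv (g (n - 1))"
    and "\<And>i j \<phi>. 1 \<le> i \<Longrightarrow> i < j \<Longrightarrow> j \<le> n \<Longrightarrow> (g j \<circ> inv (g i)) \<phi> \<noteq> \<phi>"
    and "\<And>i j \<phi>. i < n \<Longrightarrow> j < n \<Longrightarrow> i \<noteq> j \<Longrightarrow> Y (g i \<phi>) \<noteq> Y (g j \<phi>)"
    and "\<And>i \<phi>. i \<in> {1..n} \<Longrightarrow>
           circle_deriv (\<lambda>\<theta>. Y (g i \<theta>) - Y (g (i - 1) \<theta>)) \<phi>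
             \<bullet> (J *v (Y (g i \<phi>) - Y (g (i - 1) \<phi>))) \<noteq> 0"
    and "\<And>i \<phi>. i \<in> {1..n} \<Longrightarrow>
           X i \<phi> = Y (g (i - 1) \<phi>)
             - ((circle_deriv (\<lambda>\<theta>. Y (g (i - 1) \<theta>)) \<phi>
                   \<bullet> (J *v (Y (g i \<phi>) - Y (g (i - 1) \<phi>))))
                / (circle_deriv (\<lambda>\<theta>. Y (g i \<theta>) - Y (g (i - 1) \<theta>)) \<phi>
                   \<bullet> (J *v (Y (g i \<phi>) - Y (g (i - 1) \<phi>)))))
               *\<^sub>R (Y (g i \<phi>) - Y (g (i - 1) \<phi>))"
  shows "(\<forall>i\<in>{1..n}. is_envelope (X i) (\<lambda>\<phi>. Y (g (i - 1) \<phi>)) (\<lambda>\<phi>. Y (g i \<phi>)))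
       \<and> poncelet_clan n Y X
       \<and> (\<forall>\<phi>. poncelet_polygon n Y X (map (\<lambda>i. Y (g i \<phi>)) [0..<n]))"
proof -
  have Y: "C2 (\<lambda>t. Y (proj t))"
    using assms(1) unfolding regular_C2_curve_def by blast
  have g0: "g 0 = id" by (simp add: assms(7))
  have gn: "g n = id"
  proof -
    obtain m where m: "n = Suc m" using \<open>n \<ge> 3\<close> by (cases n) auto
    have "bij (g m)"
      unfolding assms(7) using assms(5) m
      by (intro bij_iter_comp) (auto simp: C2_circle_diffeo_def)
    moreover have "g n = inv (g m) \<circ> g m"
      using assms(8) by (simp add: m assms(7))
    ultimately show ?thesis by (simp add: bij_is_inj)
  qed
  have C2g: "C2 (\<lambda>t. Y (g i (proj t)))" if "i \<le> n" for i
    unfolding assms(7) using that Y assms(5)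
    by (intro iter_comp_C2_curve) (auto simp: C2_circle_diffeo_def)
  have g_mod: "g (i mod n) = g i" if "i \<le> n" for i
    using that g0 gn by (cases "i = n") auto
  have neq: "Y (g (i - 1) \<phi>) \<noteq> Y (g i \<phi>)" if i: "i \<in> {1..n}" for i \<phi>
  proof -
    have "i - 1 \<noteq> i mod n"
      using i \<open>n \<ge> 3\<close> by (cases "i = n") auto
    then have "Y (g (i - 1) \<phi>) \<noteq> Y (g (i mod n) \<phi>)"
      using i \<open>n \<ge> 3\<close> by (intro assms(10)) auto
    then show ?thesis using g_mod i by simp
  qed
  have env: "is_envelope (X i) (\<lambda>\<phi>. Y (g (i - 1) \<phi>)) (\<lambda>\<phi>. Y (g i \<phi>))" if i: "i \<in> {1..n}" for i
    using i C2g neq[OF i] assms(11)[OF i] assms(12)[OF i]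
    by (intro moving_line_envelope) auto
  have poly: "poncelet_polygon n Y X (map (\<lambda>i. Y (g i \<phi>)) [0..<n])" for \<phi>
    unfolding poncelet_polygon_def
  proof (intro conjI ballI)
    show "distinct (map (\<lambda>i. Y (g i \<phi>)) [0..<n])"
      unfolding distinct_map inj_on_def using assms(10) by (metis atLeastLessThan_iff
          distinct_upt set_upt)
    fix i assume i: "i \<in> {1..n}"
    have "line_tangent_at (X i) \<phi> (Y (g (i - 1) \<phi>)) (Y (g i \<phi>))"
      using env[OF i] unfolding is_envelope_def by blast
    moreover have "map (\<lambda>i. Y (g i \<phi>)) [0..<n] ! (i - 1) = Y (g (i - 1) \<phi>)"
      using i by (subst nth_map) auto
    moreover have "map (\<lambda>i. Y (g i \<phi>)) [0..<n] ! (i mod n) = Y (g i \<phi>)"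
      using i g_mod \<open>n \<ge> 3\<close> by simp
    ultimately show "\<exists>\<psi>. line_tangent_at (X i) \<psi> (map (\<lambda>i. Y (g i \<phi>)) [0..<n] ! (i - 1))
        (map (\<lambda>i. Y (g i \<phi>)) [0..<n] ! (i mod n))" by metis
  qed auto
  have "range Y \<subseteq> hd ` {P. poncelet_polygon n Y X P}"
  proof
    fix y assume "y \<in> range Y"
    then obtain \<phi> where "y = Y \<phi>" by blast
    then have "y = hd (map (\<lambda>i. Y (g i \<phi>)) [0..<n])"
      using \<open>n \<ge> 3\<close> g0 by (simp add: hd_map)
    then show "y \<in> hd ` {P. poncelet_polygon n Y X P}"
      using poly by blast
  qed
  then have "infinite {P. poncelet_polygon n Y X P}"
    using infinite_range_regular_curve[OF assms(1)] finite_surj by blast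
  then have "poncelet_clan n Y X"
    unfolding poncelet_clan_def closed_curve_def[of Y]
    using regular_C2_curve_continuous[OF assms(1)] env is_envelope_closed_curve by blast
  then show ?thesis using env poly by blast
qed

end
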